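(* Let $S:\mathbb{N}^{\mathbb{N}}\to\mathbb{N}^{\mathbb{N}}$ be the function with $S(\alpha)(n)=n+1$ if $n+1\notin\mathrm{im}(\alpha)$ and $S(\alpha)(n)=0$ otherwise. (a) The set $\mathbb{N}^{\mathbb{N}}$ cannot be written as a countable union $\bigcup_{i\in\mathbb{N}}V_i$ such that $S$ is continuous on each $V_i$ for the Baire space topology (i.e. each restriction $S|_{V_i}:V_i\to\mathbb{N}^{\mathbb{N}}$ is continuous, $V_i$ having the subspace topology). (b) The function $S$ is, relative to Kleene's second model $\mathcal{K}_2$, not computable in any function $F:\mathbb{N}^{\mathbb{N}}\to\mathbb{N}^{\mathbb{N}}$ with countable image; i.e. for every such $F$, $S$ is not representable in $\mathcal{K}_2[F]$.
   Context: A partial combinatory algebra (pca) is a set $\mathcal{A}$ with a partial binary application $(a,b)\mapsto ab$ (associating to the left) such that there are $\mathsf{k},\mathsf{s}\in\mathcal{A}$ with, for all $a,b,c$: $\mathsf{k}ab=a$; $\mathsf{s}ab$ is defined; and whenever $(ac)(bc)$ is defined, $\mathsf{s}abc$ is defined and equals $(ac)(bc)$. A partial function $f:\mathcal{A}\to\mathcal{A}$ is representable in $\mathcal{A}$ if there is $a_f\in\mathcal{A}$ with $a_fa=f(a)$ for all $a$ in the domain of $f$. Every pca contains booleans $\mathsf{T},\mathsf{F}$ with a definition-by-cases element $D$ ($D\mathsf{T}ab=a$, $D\mathsf{F}ab=b$), and standard codings $[a,b]$ of pairs and $[a_0,\ldots,a_{n-1}]$ of finite sequences whose basic operations (length, projections,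 appending) are representable; fix such choices. For a pca $\mathcal{A}$ and a partial function $f:\mathcal{A}\to\mathcal{A}$, $\mathcal{A}[f]$ is the pca with underlying set $\mathcal{A}$ and application $\cdot_f$ defined by: $a\cdot_f b=c$ iff there is a finite sequence $e_0,\ldots,e_{n-1}$ in $\mathcal{A}$ (on each of which $f$ is defined) such that $a[b,f(e_0),\ldots,f(e_{i-1})]=[\mathsf{F},e_i]$ for all $i<n$ and $a[b,f(e_0),\ldots,f(e_{n-1})]=[\mathsf{T},c]$. $\mathcal{K}_2$ (Kleene's second model): underlying set $\mathbb{N}^{\mathbb{N}}$; $\alpha\beta$ is defined iff for every $n$ there is $k$ with $\alpha([n,\beta(0),\ldots,\beta(k-1)])>0$ (with $[\cdot,\ldots,\cdot]$ a standard coding of finite sequences of naturals by naturals), and then $(\alpha\beta)(n)=\alpha([n,\beta(0),\ldots,\beta(k-1)])-1$ for the least such $k$. The Baire space topology on $\mathbb{N}^{\mathbb{N}}$ is the product topology of discrete copies of $\mathbb{N}$. It is well known that a partial function on $\mathbb{N}^{\mathbb{N}}$ is representable in $\mathcal{K}_2$ iff it is continuous on its domain. *)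

theory Defs
  imports "HOL-Analysis.Function_Topology" "HOL-Library.Nat_Bijection" "HOL-Library.Monad_Syntax"
begin

section \<open>Partial combinatory algebras\<close>

text \<open>A partial binary application is a function into \<open>'a option\<close>, with \<open>None\<close> for
  ``undefined''. The operators below are application to two and to three arguments, associating to
  the left.\<close>

definition app2 :: "('a \<Rightarrow> 'a \<Rightarrow> 'a option) \<Rightarrow> 'a \<Rightarrow> 'a \<Rightarrow> 'a \<Rightarrow> 'a option" where
  "app2 app a b c = app a b \<bind> (\<lambda>x. app x c)"

definition app3 :: "('a \<Rightarrow> 'a \<Rightarrow> 'a option) \<Rightarrow> 'a \<Rightarrow> 'a \<Rightarrow> 'a \<Rightarrow> 'a \<Rightarrow> 'a option" where
  "app3 app a b c d = app2 app a b c \<bind> (\<lambda>x. app x d)"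

locale pca =
  fixes app :: "'a \<Rightarrow> 'a \<Rightarrow> 'a option"
  assumes ex_k_s:
    "\<exists>k s. \<forall>a b c. app2 app k a b = Some a \<and> app2 app s a b \<noteq> None \<and>
       (\<forall>d. app a c \<bind> (\<lambda>ac. app b c \<bind> (\<lambda>bc. app ac bc)) = Some d
              \<longrightarrow> app3 app s a b c = Some d)"

definition representable :: "('a \<Rightarrow> 'a \<Rightarrow> 'a option) \<Rightarrow> ('a \<Rightarrow> 'a option) \<Rightarrow> bool" where
  "representable app f \<longleftrightarrow> (\<exists>r. \<forall>a c. f a = Some c \<longrightarrow> app r a = Some c)"

text \<open>A choice of booleans \<open>tt\<close>, \<open>ff\<close>, of a pair coding, of numerals, and of a coding of finite
  sequences, all with representable basic operations. Numerals are part of the choice because the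
  length of a sequence and the index of a projection have to be represented as elements of the
  algebra.\<close>

locale pca_coding = pca app
  for app :: "'a \<Rightarrow> 'a \<Rightarrow> 'a option" +
  fixes tt ff :: 'a
    and pair :: "'a \<Rightarrow> 'a \<Rightarrow> 'a"
    and num :: "nat \<Rightarrow> 'a"
    and sq :: "'a list \<Rightarrow> 'a"
  assumes ex_cases: "\<exists>d. \<forall>a b. app3 app d tt a b = Some a \<and> app3 app d ff a b = Some b"
    and ex_pair: "\<exists>p. \<forall>a b. app2 app p a b = Some (pair a b)"
    and ex_fst: "\<exists>p. \<forall>a b. app p (pair a b) = Some a"
    and ex_snd: "\<exists>p. \<forall>a b. app p (pair a b) = Some b"
    and ex_succ: "\<exists>s. \<forall>n. app s (num n) = Some (num (Suc n))"
    and ex_pred: "\<exists>p. \<forall>n. app p (num (Suc n)) = Some (num n)"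
    and ex_zero: "\<exists>z. \<forall>n. app z (num n) = Some (if n = 0 then tt else ff)"
    and ex_length: "\<exists>l. \<forall>xs. app l (sq xs) = Some (num (length xs))"
    and ex_nth: "\<exists>p. \<forall>xs i. i < length xs \<longrightarrow> app2 app p (num i) (sq xs) = Some (xs ! i)"
    and ex_append: "\<exists>p. \<forall>xs x. app2 app p (sq xs) x = Some (sq (xs @ [x]))"
begin

text \<open>The algebra \<open>\<A>[f]\<close>: \<open>oracle_run f a b c\<close> is the relation \<open>a \<cdot>\<^sub>f b = c\<close>, and \<open>es\<close> is the list
  of queries put to the oracle.\<close>

definition oracle_run :: "('a \<Rightarrow> 'a option) \<Rightarrow> 'a \<Rightarrow> 'a \<Rightarrow> 'a \<Rightarrow> bool" where
  "oracle_run f a b c \<longleftrightarrow>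
     (\<exists>es. set es \<subseteq> dom f \<and>
        (\<forall>i < length es.
           app a (sq (b # map (the \<circ> f) (take i es))) = Some (pair ff (es ! i))) \<and>
        app a (sq (b # map (the \<circ> f) es)) = Some (pair tt c))"

definition oracle_app :: "('a \<Rightarrow> 'a option) \<Rightarrow> 'a \<Rightarrow> 'a \<Rightarrow> 'a option" where
  "oracle_app f a b =
     (if \<exists>c. oracle_run f a b c then Some (THE c. oracle_run f a b c) else None)"

lemma pair_inject:
  assumes "pair a b = pair a' b'"
  shows "a = a' \<and> b = b'"
  using ex_fst ex_snd assms by (metis option.inject)

lemma tt_eq_ff_imp_trivial:
  assumes "tt = ff"
  shows "(a::'a) = b"
  using ex_cases assms by (metis option.inject)

lemma oracle_run_unique:
  assumes "oracle_run f a b c" and "oracle_run f a b c'"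
  shows "c = c'"
proof (cases "tt = ff")
  case True
  then show ?thesis by (rule tt_eq_ff_imp_trivial)
next
  case False
  have main: "x = x'"
    if "length es \<le> length es'"
      and q: "\<forall>i < length es. app a (sq (b # map (the \<circ> f) (take i es))) = Some (pair ff (es ! i))"
      and r: "app a (sq (b # map (the \<circ> f) es)) = Some (pair tt x)"
      and q': "\<forall>i < length es'. app a (sq (b # map (the \<circ> f) (take i es'))) = Some (pair ff (es' ! i))"
      and r': "app a (sq (b # map (the \<circ> f) es')) = Some (pair tt x')"
    for es es' x x'
  proof -
    have pre: "take i es = take i es'" if "i \<le> length es" for i
      using that
    proof (induction i)
      case (Suc i)
      then have eq: "take i es = take i es'" and i: "i < length es" "i < length es'"
        using \<open>length es \<le> length es'\<close> by auto
      have "pair ff (es ! i) = pair ff (es' ! i)"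
        using q q' i eq by (metis option.inject)
      then have "es ! i = es' ! i"
        using pair_inject by blast
      then show ?case
        using eq i by (simp add: take_Suc_conv_app_nth)
    qed simp
    have es: "es = take (length es) es'"
      using pre[of "length es"] by simp
    have "length es = length es'"
    proof (rule ccontr)
      assume "length es \<noteq> length es'"
      then have "length es < length es'"
        using \<open>length es \<le> length es'\<close> by simp
      then have "pair tt x = pair ff (es' ! length es)"
        using q' r es by (metis option.inject)
      then show False
        using pair_inject False by blast
    qed
    then have "es = es'"
      using es by simp
    then show "x = x'"
      using r r' pair_inject by (metis option.inject)
  qed
  obtain es where es:
    "\<forall>i < length es. app a (sq (b # map (the \<circ> f) (take i es))) = Some (pair ff (es ! i))"
    "app a (sq (b # map (the \<circ> f) es)) = Some (pair tt c)"
    using assms(1) unfolding oracle_run_def by blast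
  obtain es' where es':
    "\<forall>i < length es'. app a (sq (b # map (the \<circ> f) (take i es'))) = Some (pair ff (es' ! i))"
    "app a (sq (b # map (the \<circ> f) es')) = Some (pair tt c')"
    using assms(2) unfolding oracle_run_def by blast
  show ?thesis
    using main[OF _ es es'] main[OF _ es' es] by (metis nat_le_linear)
qed

lemma oracle_app_eq_Some_iff: "oracle_app f a b = Some c \<longleftrightarrow> oracle_run f a b c"
proof -
  have "(THE c. oracle_run f a b c) = c" if "oracle_run f a b c" for c
    using that oracle_run_unique by blast
  then show ?thesis
    unfolding oracle_app_def by (metis option.distinct(1) option.inject)
qed

end

section \<open>Kleene's second model\<close>

text \<open>The bijection \<open>list_encode\<close> is the coding of finite sequences of natural numbers.\<close>

definition k2_app :: "(nat \<Rightarrow> nat) \<Rightarrow> (nat \<Rightarrow> nat) \<Rightarrow> (nat \<Rightarrow> nat) option" where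
  "k2_app \<alpha> \<beta> =
     (if \<forall>n. \<exists>k. \<alpha> (list_encode (n # map \<beta> [0..<k])) > 0
      then Some (\<lambda>n. \<alpha> (list_encode
             (n # map \<beta> [0..<(LEAST k. \<alpha> (list_encode (n # map \<beta> [0..<k])) > 0)])) - 1)
      else None)"

text \<open>The function \<open>S\<close>. The Baire space topology on its domain and codomain is the type class topology
  of \<open>nat \<Rightarrow> nat\<close>: the product topology of the discrete topology on \<open>nat\<close>.\<close>

definition missing_succ :: "(nat \<Rightarrow> nat) \<Rightarrow> (nat \<Rightarrow> nat)" where
  "missing_succ \<alpha> n = (if n + 1 \<notin> range \<alpha> then n + 1 else 0)"

section \<open>Kleene's second model admits codings\<close>

text \<open>That \<open>k2_app\<close> is a partial combinatory algebra and admits codings as above is shown by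
  representing continuous functions.\<close>

type_synonym baire = "nat \<Rightarrow> nat"

definition agree :: "nat \<Rightarrow> baire \<Rightarrow> baire \<Rightarrow> bool" where
  "agree k x y \<longleftrightarrow> (\<forall>i<k. x i = y i)"

lemma open_agree: "open {y. agree k x y}"
proof -
  have "open {y. \<forall>i\<in>{..<k}. y i \<in> {x i}}"
    by (rule product_topology_basis'[where x = "\<lambda>i. i"]) (auto simp: open_discrete)
  moreover have "{y. \<forall>i\<in>{..<k}. y i \<in> {x i}} = {y. agree k x y}"
    by (auto simp: agree_def)
  ultimately show ?thesis
    by simp
qed

lemma agree_subset_open:
  assumes "open U" and "x \<in> U"
  shows "\<exists>k. {y. agree k x y} \<subseteq> U"
proof -
  obtain X where X: "x \<in> (\<Pi>\<^sub>E i\<in>UNIV. X i)" "finite {i. X i \<noteq> UNIV}" "(\<Pi>\<^sub>E i\<in>UNIV. X i) \<subseteq> U"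
    using product_topology_open_contains_basis[OF assms(1)[unfolded open_fun_def] assms(2)]
    unfolding topspace_euclidean by blast
  obtain k where k: "\<And>i. X i \<noteq> UNIV \<Longrightarrow> i < k"
    using X(2) unfolding finite_nat_set_iff_bounded by blast
  have "y \<in> U" if "agree k x y" for y
  proof -
    have "y i \<in> X i" for i
      using X(1) k[of i] that unfolding agree_def PiE_iff by (metis UNIV_I)
    then have "y \<in> (\<Pi>\<^sub>E i\<in>UNIV. X i)"
      by (simp add: PiE_iff)
    then show ?thesis
      using X(3) by (rule subsetD[rotated])
  qed
  then show ?thesis
    by blast
qed

lemma continuous_on_baire_nbhds:
  fixes g :: "'x::topological_space \<Rightarrow> baire"
  assumes op: "\<And>x k. open (N x k)" and mem: "\<And>x k. x \<in> N x k"
    and cof: "\<And>U x. open U \<Longrightarrow> x \<in> U \<Longrightarrow> \<exists>k::nat. N x k \<subseteq> U"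
  shows "continuous_on D g \<longleftrightarrow> (\<forall>x\<in>D. \<forall>n. \<exists>k. \<forall>y\<in>D \<inter> N x k. g y n = g x n)"
proof
  assume g: "continuous_on D g"
  show "\<forall>x\<in>D. \<forall>n. \<exists>k. \<forall>y\<in>D \<inter> N x k. g y n = g x n"
  proof (intro ballI allI)
    fix x n assume x: "x \<in> D"
    have "g x \<in> {z. agree (Suc n) (g x) z}"
      by (simp add: agree_def)
    then obtain A where A: "open A" "x \<in> A" "\<forall>y\<in>D. y \<in> A \<longrightarrow> g y \<in> {z. agree (Suc n) (g x) z}"
      using g[unfolded continuous_on_topological, rule_format, OF x open_agree] by blast
    obtain k where k: "N x k \<subseteq> A"
      using cof[OF A(1,2)] by blast
    have "g y n = g x n" if "y \<in> D \<inter> N x k" for y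
    proof -
      have "agree (Suc n) (g x) (g y)"
        using that k A(3) by blast
      then show ?thesis
        by (simp add: agree_def)
    qed
    then show "\<exists>k. \<forall>y\<in>D \<inter> N x k. g y n = g x n"
      by blast
  qed
next
  assume loc: "\<forall>x\<in>D. \<forall>n. \<exists>k. \<forall>y\<in>D \<inter> N x k. g y n = g x n"
  show "continuous_on D g"
  proof (rule continuous_on_coordinatewise_then_product)
    fix n
    show "continuous_on D (\<lambda>x. g x n)"
      unfolding continuous_on_topological
    proof (intro ballI allI impI)
      fix x and B :: "nat set" assume "x \<in> D" "open B" "g x n \<in> B"
      then obtain k where "\<forall>y\<in>D \<inter> N x k. g y n = g x n"
        using loc by blast
      then show "\<exists>A. open A \<and> x \<in> A \<and> (\<forall>y\<in>D. y \<in> A \<longrightarrow> g y n \<in> B)"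
        using op mem \<open>g x n \<in> B\<close> by (metis IntI)
    qed
  qed
qed

lemma continuous_on_baire_iff:
  fixes g :: "baire \<Rightarrow> baire"
  shows "continuous_on D g \<longleftrightarrow> (\<forall>x\<in>D. \<forall>n. \<exists>k. \<forall>y\<in>D. agree k x y \<longrightarrow> g y n = g x n)"
proof -
  have "continuous_on D g \<longleftrightarrow> (\<forall>x\<in>D. \<forall>n. \<exists>k. \<forall>y\<in>D \<inter> {y. agree k x y}. g y n = g x n)"
    by (intro continuous_on_baire_nbhds agree_subset_open open_agree) (auto simp: agree_def)
  then show ?thesis
    unfolding Ball_def Int_iff mem_Collect_eq imp_conjL .
qed

lemma agree_mono: "agree l x y \<Longrightarrow> k \<le> l \<Longrightarrow> agree k x y"
  by (auto simp: agree_def)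

lemma continuous_on_baire2_iff:
  fixes g :: "baire \<times> baire \<Rightarrow> baire"
  shows "continuous_on D g \<longleftrightarrow>
    (\<forall>(a, b)\<in>D. \<forall>n. \<exists>k. \<forall>(a', b')\<in>D. agree k a a' \<longrightarrow> agree k b b' \<longrightarrow> g (a', b') n = g (a, b) n)"
proof -
  have eq: "{y. agree k (fst x) y} \<times> {y. agree k (snd x) y} =
      {y. agree k (fst x) (fst y) \<and> agree k (snd x) (snd y)}" for k x
    by auto
  have "\<exists>k. {y. agree k (fst x) y} \<times> {y. agree k (snd x) y} \<subseteq> U"
    if U: "open U" "x \<in> U" for U x
  proof -
    obtain A B where AB: "open A" "open B" "x \<in> A \<times> B" "A \<times> B \<subseteq> U"
      using open_prod_elim[OF U] by blast
    then obtain k l where "{y. agree k (fst x) y} \<subseteq> A" "{y. agree l (snd x) y} \<subseteq> B"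
      by (metis agree_subset_open mem_Times_iff)
    then have "{y. agree (max k l) (fst x) y} \<times> {y. agree (max k l) (snd x) y} \<subseteq> U"
      using AB(4) agree_mono[of "max k l"] by fastforce
    then show ?thesis
      by blast
  qed
  then have "continuous_on D g \<longleftrightarrow>
      (\<forall>x\<in>D. \<forall>n. \<exists>k. \<forall>y\<in>D \<inter> {y. agree k (fst x) y} \<times> {y. agree k (snd x) y}. g y n = g x n)"
    by (intro continuous_on_baire_nbhds open_Times open_agree) (auto simp: agree_def)
  then show ?thesis
    unfolding eq by (simp add: Ball_def split_paired_All imp_conjL)
qed

lemma k2_app_eqI:
  assumes "\<And>n. \<exists>k. \<alpha> (list_encode (n # map \<beta> [0..<k])) > 0"
    and "\<And>n k. \<alpha> (list_encode (n # map \<beta> [0..<k])) > 0 \<Longrightarrow>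
           \<alpha> (list_encode (n # map \<beta> [0..<k])) = \<gamma> n + 1"
  shows "k2_app \<alpha> \<beta> = Some \<gamma>"
proof -
  have "\<alpha> (list_encode (n # map \<beta> [0..<(LEAST k. \<alpha> (list_encode (n # map \<beta> [0..<k])) > 0)])) = \<gamma> n + 1" for n
    by (rule assms(2)) (rule LeastI_ex, rule assms(1))
  then show ?thesis
    using assms(1) by (simp add: k2_app_def)
qed

lemma k2_curry:
  fixes g :: "baire \<times> baire \<Rightarrow> baire"
  assumes "continuous_on D g"
  shows "\<exists>h. continuous_on UNIV h \<and> (\<forall>a b. (a, b) \<in> D \<longrightarrow> k2_app (h a) b = Some (g (a, b)))"
proof -
  define P where "P a n xs v \<longleftrightarrow>
    (\<forall>a' b'. (a', b') \<in> D \<longrightarrow> agree (length xs) a a' \<longrightarrow> (\<forall>i<length xs. b' i = xs ! i) \<longrightarrow> g (a', b') n = v)"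
    for a n xs v
  define h where "h a m = (case list_decode m of [] \<Rightarrow> 0 | n # xs \<Rightarrow>
    if \<exists>v. P a n xs v then Suc (SOME v. P a n xs v) else 0)" for a m
  have "continuous_on UNIV h"
    unfolding continuous_on_baire_iff
  proof (intro ballI allI)
    fix a m
    have "h a' m = h a m" if "agree (length (list_decode m)) a a'" for a'
    proof (cases "list_decode m")
      case (Cons n xs)
      then have "P a' n xs = P a n xs"
        using that by (auto simp: P_def agree_def fun_eq_iff)
      then show ?thesis
        by (simp add: h_def Cons)
    qed (simp add: h_def)
    then show "\<exists>k. \<forall>y\<in>UNIV. agree k a y \<longrightarrow> h y m = h a m"
      by blast
  qed
  moreover have "k2_app (h a) b = Some (g (a, b))" if ab: "(a, b) \<in> D" for a b
  proof (rule k2_app_eqI)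
    fix n
    obtain k where k: "\<And>a' b'. (a', b') \<in> D \<Longrightarrow> agree k a a' \<Longrightarrow> agree k b b' \<Longrightarrow> g (a', b') n = g (a, b) n"
      using assms ab unfolding continuous_on_baire2_iff by fast
    then have "P a n (map b [0..<k]) (g (a, b) n)"
      by (auto simp: P_def agree_def)
    then show "\<exists>k. h a (list_encode (n # map b [0..<k])) > 0"
      by (intro exI[of _ k]) (auto simp: h_def)
  next
    fix n k
    assume pos: "h a (list_encode (n # map b [0..<k])) > 0"
    let ?v = "SOME v. P a n (map b [0..<k]) v"
    have ex: "\<exists>v. P a n (map b [0..<k]) v"
      using pos unfolding h_def list_encode_inverse list.case by presburger
    then have "P a n (map b [0..<k]) ?v"
      by (rule someI_ex)
    then have "g (a, b) n = ?v"
      using ab by (simp add: P_def agree_def)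
    then show "h a (list_encode (n # map b [0..<k])) = g (a, b) n + 1"
      using ex unfolding h_def list_encode_inverse list.case by simp
  qed
  ultimately show ?thesis
    by blast
qed

lemma k2_rep1:
  fixes g :: "baire \<Rightarrow> baire"
  assumes "continuous_on D g"
  shows "\<exists>r. \<forall>b\<in>D. k2_app r b = Some (g b)"
proof -
  have "continuous_on (UNIV \<times> D) (g \<circ> snd)"
    by (rule continuous_on_compose)
      (auto intro: continuous_on_snd continuous_on_id continuous_on_subset[OF assms])
  from k2_curry[OF this] show ?thesis
    by auto
qed

lemma k2_rep2:
  fixes g :: "baire \<times> baire \<Rightarrow> baire"
  assumes "continuous_on D g"
  shows "\<exists>r. (\<forall>a. k2_app r a \<noteq> None) \<and> (\<forall>a b. (a, b) \<in> D \<longrightarrow> app2 k2_app r a b = Some (g (a, b)))"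
proof -
  obtain h where h: "continuous_on UNIV h" "\<And>a b. (a, b) \<in> D \<Longrightarrow> k2_app (h a) b = Some (g (a, b))"
    using k2_curry[OF assms] by blast
  obtain r where "\<And>a. k2_app r a = Some (h a)"
    using k2_rep1[OF h(1)] by auto
  then show ?thesis
    using h(2) by (intro exI[of _ r]) (simp add: app2_def)
qed

definition k2_pair :: "baire \<Rightarrow> baire \<Rightarrow> baire" where
  "k2_pair a b n = (if even n then a (n div 2) else b (n div 2))"

definition k2_fst :: "baire \<Rightarrow> baire" where "k2_fst p n = p (2 * n)"
definition k2_snd :: "baire \<Rightarrow> baire" where "k2_snd p n = p (2 * n + 1)"

lemma k2_fst_pair [simp]: "k2_fst (k2_pair a b) = a"
  and k2_snd_pair [simp]: "k2_snd (k2_pair a b) = b"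
  by (auto simp: fun_eq_iff k2_fst_def k2_snd_def k2_pair_def)

lemma continuous_on_k2_fst: "continuous_on D k2_fst"
  and continuous_on_k2_snd: "continuous_on D k2_snd"
  unfolding continuous_on_baire_iff k2_fst_def k2_snd_def agree_def by (metis lessI)+

lemma continuous_on_k2_pair: "continuous_on D (\<lambda>x. k2_pair (fst x) (snd x))"
  unfolding continuous_on_baire2_iff
proof safe
  fix a b n
  show "\<exists>k. \<forall>(a', b')\<in>D. agree k a a' \<longrightarrow> agree k b b' \<longrightarrow>
      k2_pair (fst (a', b')) (snd (a', b')) n = k2_pair (fst (a, b)) (snd (a, b)) n"
    by (intro exI[of _ "Suc n"]) (auto simp: agree_def k2_pair_def)
qed

lemma k2_rep3:
  fixes g :: "(baire \<times> baire) \<times> baire \<Rightarrow> baire"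
  assumes "continuous_on D g"
  shows "\<exists>r. (\<forall>a b. app2 k2_app r a b \<noteq> None) \<and>
           (\<forall>a b c. ((a, b), c) \<in> D \<longrightarrow> app3 k2_app r a b c = Some (g ((a, b), c)))"
proof -
  define \<phi> where "\<phi> x = ((k2_fst (fst x), k2_snd (fst x)), snd x)" for x :: "baire \<times> baire"
  have 1: "continuous_on UNIV (\<lambda>x :: baire \<times> baire. k2_fst (fst x))"
    by (rule continuous_on_compose2[OF continuous_on_k2_fst[of UNIV]])
      (simp_all add: continuous_on_fst continuous_on_id)
  have 2: "continuous_on UNIV (\<lambda>x :: baire \<times> baire. k2_snd (fst x))"
    by (rule continuous_on_compose2[OF continuous_on_k2_snd[of UNIV]])
      (simp_all add: continuous_on_fst continuous_on_id)
  have "continuous_on UNIV \<phi>"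
    unfolding \<phi>_def[abs_def]
    by (rule continuous_on_Pair[OF continuous_on_Pair[OF 1 2]])
      (simp add: continuous_on_snd continuous_on_id)
  then have "continuous_on (\<phi> -` D) \<phi>"
    by (rule continuous_on_subset) simp
  then have "continuous_on (\<phi> -` D) (\<lambda>x. g (\<phi> x))"
    by (rule continuous_on_compose2[OF assms]) (simp add: image_vimage_subset)
  from k2_curry[OF this] obtain h where h: "continuous_on UNIV h"
    "\<And>p c. (p, c) \<in> \<phi> -` D \<Longrightarrow> k2_app (h p) c = Some (g (\<phi> (p, c)))"
    by blast
  have "continuous_on UNIV (\<lambda>x. h (k2_pair (fst x) (snd x)))"
    by (rule continuous_on_compose2[OF h(1) continuous_on_k2_pair]) simp
  from k2_rep2[OF this] obtain r where r: "\<And>a b. app2 k2_app r a b = Some (h (k2_pair a b))"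
    by auto
  have "app3 k2_app r a b c = Some (g ((a, b), c))" if "((a, b), c) \<in> D" for a b c
    using h(2)[of "k2_pair a b" c] that by (simp add: app3_def r \<phi>_def)
  then show ?thesis
    using r by (intro exI[of _ r]) simp
qed

lemma map_upt_agree: "agree k x y \<Longrightarrow> map x [0..<k] = map y [0..<k]"
  by (auto simp: agree_def)

lemma k2_app_nth:
  assumes "k2_app a b \<noteq> None"
  shows "the (k2_app a b) n =
    a (list_encode (n # map b [0..<(LEAST k. a (list_encode (n # map b [0..<k])) > 0)])) - 1"
proof (cases "\<forall>n. \<exists>k. a (list_encode (n # map b [0..<k])) > 0")
  case True
  then show ?thesis
    unfolding k2_app_def by (simp only: if_True option.sel simp_thms)
next
  case False
  then show ?thesis
    using assms unfolding k2_app_def by (simp only: if_False simp_thms)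
qed

lemma continuous_on_k2_app:
  "continuous_on {x. k2_app (fst x) (snd x) \<noteq> None} (\<lambda>x. the (k2_app (fst x) (snd x)))"
  unfolding continuous_on_baire2_iff
proof (intro ballI case_prodI2 allI)
  fix x a b n
  assume "x \<in> {x. k2_app (fst x) (snd x) \<noteq> None}" and "x = (a, b)"
  then have def: "k2_app a b \<noteq> None"
    by simp
  let ?Q = "\<lambda>a b k. a (list_encode (n # map b [0..<k])) > (0::nat)"
  define l where "l = (LEAST k. ?Q a b k)"
  have "\<exists>k. ?Q a b k"
    using def by (auto simp: k2_app_def split: if_splits)
  then have l: "?Q a b l" "\<And>k. k < l \<Longrightarrow> \<not> ?Q a b k"
    unfolding l_def by (rule LeastI_ex) (rule not_less_Least)
  define K where "K = Suc (Max ((\<lambda>k. list_encode (n # map b [0..<k])) ` {..l}) + l)"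
  have K: "list_encode (n # map b [0..<k]) < K" if "k \<le> l" for k
    using that unfolding K_def by (intro le_imp_less_Suc trans_le_add1 Max_ge) auto
  have "the (k2_app a' b') n = the (k2_app a b) n"
    if ag: "agree K a a'" "agree K b b'" and def': "k2_app a' b' \<noteq> None" for a' b'
  proof -
    have eq: "a' (list_encode (n # map b' [0..<k])) = a (list_encode (n # map b [0..<k]))"
      if "k \<le> l" for k
    proof -
      have "map b' [0..<k] = map b [0..<k]"
        using map_upt_agree[OF agree_mono[OF ag(2), of k]] that unfolding K_def by simp
      then show ?thesis
        using ag(1) K[OF that] unfolding agree_def by metis
    qed
    have "(LEAST k. ?Q a' b' k) = l"
      using l eq by (intro Least_equality) (auto simp: not_less[symmetric])
    then show ?thesis
      using eq[of l] k2_app_nth[of a b n] k2_app_nth[OF def', of n] def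
      unfolding l_def[symmetric] by simp
  qed
  then show "\<exists>k. \<forall>(a', b')\<in>{x. k2_app (fst x) (snd x) \<noteq> None}. agree k a a' \<longrightarrow> agree k b b' \<longrightarrow>
      the (k2_app (fst (a', b')) (snd (a', b'))) n = the (k2_app (fst (a, b)) (snd (a, b))) n"
    by auto
qed

lemma pca_k2: "pca k2_app"
proof
  obtain k where k: "\<And>a b. app2 k2_app k a b = Some a"
    using k2_rep2[OF continuous_on_fst[OF continuous_on_id[of UNIV]]] by auto
  let ?E = "{x. k2_app (fst x) (snd x) \<noteq> None}"
  let ?ap = "\<lambda>x. the (k2_app (fst x) (snd x))"
  let ?D1 = "{((a, b), c). k2_app a c \<noteq> None \<and> k2_app b c \<noteq> None}"
  let ?i = "\<lambda>x. (?ap (fst (fst x), snd x), ?ap (snd (fst x), snd x))"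
  let ?D = "?D1 \<inter> ?i -` ?E"
  have cf: "continuous_on ?D (\<lambda>x. (fst (fst x), snd x))" "continuous_on ?D (\<lambda>x. (snd (fst x), snd x))"
    by (intro continuous_on_Pair continuous_on_fst continuous_on_snd continuous_on_id)+
  have "continuous_on ?D ?i"
    by (intro continuous_on_Pair continuous_on_compose2[OF continuous_on_k2_app cf(1)]
        continuous_on_compose2[OF continuous_on_k2_app cf(2)]) auto
  then have "continuous_on ?D (\<lambda>x. ?ap (?i x))"
    by (rule continuous_on_compose2[OF continuous_on_k2_app]) auto
  then obtain s where s: "\<And>a b. app2 k2_app s a b \<noteq> None"
    "\<And>a b c. ((a, b), c) \<in> ?D \<Longrightarrow> app3 k2_app s a b c = Some (?ap (?i ((a, b), c)))"
    using k2_rep3 by blast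
  have "app3 k2_app s a b c = Some d"
    if prem: "k2_app a c \<bind> (\<lambda>ac. k2_app b c \<bind> (\<lambda>bc. k2_app ac bc)) = Some d" for a b c d
  proof -
    obtain ac bc where "k2_app a c = Some ac" "k2_app b c = Some bc" "k2_app ac bc = Some d"
      using prem by (auto simp: Option.bind_eq_Some_conv)
    then show ?thesis
      using s(2)[of a b c] by auto
  qed
  then show "\<exists>k s. \<forall>a b c. app2 k2_app k a b = Some a \<and> app2 k2_app s a b \<noteq> None \<and>
       (\<forall>d. k2_app a c \<bind> (\<lambda>ac. k2_app b c \<bind> (\<lambda>bc. k2_app ac bc)) = Some d
              \<longrightarrow> app3 k2_app s a b c = Some d)"
    using k s(1) by blast
qed

definition k2_seq :: "baire list \<Rightarrow> baire" where
  "k2_seq xs n = (case n of 0 \<Rightarrow> length xs | Suc m \<Rightarrow>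
     (case prod_decode m of (i, j) \<Rightarrow> if i < length xs then (xs ! i) j else 0))"

lemma pca_coding_k2:
  "pca_coding k2_app (\<lambda>_. 0) (\<lambda>_. 1) k2_pair (\<lambda>n _. n) k2_seq"
proof (intro pca_coding.intro pca_k2 pca_coding_axioms.intro)
  let ?d = "\<lambda>x :: (baire \<times> baire) \<times> baire. (if fst (fst x) 0 = 0 then snd (fst x) else snd x)"
  let ?A = "\<lambda>S :: nat set. {x :: (baire \<times> baire) \<times> baire. fst (fst x) 0 \<in> S}"
  have c: "continuous_on UNIV (\<lambda>x :: (baire \<times> baire) \<times> baire. fst (fst x) 0)"
    by (rule continuous_on_product_then_coordinatewise) (intro continuous_on_fst continuous_on_id)
  have op: "open (?A S)" for S
    using open_vimage[OF open_discrete c, of S] by (simp add: vimage_def)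
  have 1: "continuous_on (?A {0}) ?d"
    by (rule continuous_on_eq[of _ "\<lambda>x. snd (fst x)"])
      (intro continuous_on_snd continuous_on_fst continuous_on_id, simp)
  have 2: "continuous_on (?A (- {0})) ?d"
    by (rule continuous_on_eq[of _ snd])
      (intro continuous_on_snd continuous_on_id, simp)
  have "?A {0} \<union> ?A (- {0}) = UNIV"
    by blast
  then have "continuous_on UNIV ?d"
    using continuous_on_open_Un[OF op op 1 2] by (simp only:)
  from k2_rep3[OF this] obtain d where "\<And>a b c. app3 k2_app d a b c = Some (?d ((a, b), c))"
    by blast
  then show "\<exists>d. \<forall>a b. app3 k2_app d (\<lambda>_. 0) a b = Some a \<and> app3 k2_app d (\<lambda>_. 1) a b = Some b"
    by (intro exI[of _ d]) simp
next
  show "\<exists>p. \<forall>a b. app2 k2_app p a b = Some (k2_pair a b)"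
    using k2_rep2[OF continuous_on_k2_pair[of UNIV]] by auto
next
  show "\<exists>p. \<forall>a b. k2_app p (k2_pair a b) = Some a"
    using k2_rep1[OF continuous_on_k2_fst[of UNIV]] by (metis UNIV_I k2_fst_pair)
next
  show "\<exists>p. \<forall>a b. k2_app p (k2_pair a b) = Some b"
    using k2_rep1[OF continuous_on_k2_snd[of UNIV]] by (metis UNIV_I k2_snd_pair)
next
  have *: "continuous_on UNIV (\<lambda>(x::baire) (i::nat). f (x 0))" for f :: "nat \<Rightarrow> nat"
    unfolding continuous_on_baire_iff agree_def by (metis lessI)
  show "\<exists>s. \<forall>n. k2_app s (\<lambda>_. n) = Some (\<lambda>_. Suc n)"
    using k2_rep1[OF *[of Suc]] by auto
  show "\<exists>p. \<forall>n. k2_app p (\<lambda>_. Suc n) = Some (\<lambda>_. n)"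
    using k2_rep1[OF *[of "\<lambda>n. n - 1"]] by (metis UNIV_I diff_Suc_1)
  show "\<exists>z. \<forall>n. k2_app z (\<lambda>_. n) = Some (if n = 0 then \<lambda>_. 0 else (\<lambda>_. 1))"
  proof -
    obtain z where "\<And>b. k2_app z b = Some (\<lambda>_. if b 0 = 0 then 0 else 1)"
      using k2_rep1[OF *[of "\<lambda>n. if n = 0 then 0 else 1"]] by blast
    then show ?thesis
      by (intro exI[of _ z]) simp
  qed
  show "\<exists>l. \<forall>xs. k2_app l (k2_seq xs) = Some (\<lambda>_. length xs)"
  proof -
    obtain l where "\<And>b. k2_app l b = Some (\<lambda>_. b 0)"
      using k2_rep1[OF *[of "\<lambda>n. n"]] by blast
    then show ?thesis
      by (intro exI[of _ l]) (simp add: k2_seq_def)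
  qed
next
  define g where "g x j = snd x (Suc (prod_encode (fst x 0, j)))" for x :: "baire \<times> baire" and j
  have "continuous_on UNIV g"
    unfolding continuous_on_baire2_iff
  proof (intro ballI case_prodI2 allI)
    fix x a b n
    show "\<exists>k. \<forall>(a', b')\<in>UNIV. agree k a a' \<longrightarrow> agree k b b' \<longrightarrow> g (a', b') n = g (a, b) n"
      by (intro exI[of _ "Suc (Suc (prod_encode (a 0, n)))"]) (auto simp: agree_def g_def)
  qed
  from k2_rep2[OF this] obtain p where p: "\<And>a b. app2 k2_app p a b = Some (g (a, b))"
    by blast
  have "g (\<lambda>_. i, k2_seq xs) = xs ! i" if "i < length xs" for i xs
    using that by (simp add: g_def k2_seq_def fun_eq_iff)
  then show "\<exists>p. \<forall>xs i. i < length xs \<longrightarrow> app2 k2_app p (\<lambda>_. i) (k2_seq xs) = Some (xs ! i)"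
    by (intro exI[of _ p]) (simp add: p)
next
  define g where "g x n = (if n = 0 then Suc (fst x 0)
      else if fst (prod_decode (n - 1)) < fst x 0 then fst x n
      else if fst (prod_decode (n - 1)) = fst x 0 then snd x (snd (prod_decode (n - 1)))
      else 0)" for x :: "baire \<times> baire" and n
  have "continuous_on UNIV g"
    unfolding continuous_on_baire2_iff
  proof (intro ballI case_prodI2 allI)
    fix x a b n
    have "g (a', b') n = g (a, b) n"
      if "agree (Suc (n + snd (prod_decode (n - 1)))) a a'"
        "agree (Suc (n + snd (prod_decode (n - 1)))) b b'" for a' b'
      using that by (simp add: agree_def g_def)
    then show "\<exists>k. \<forall>(a', b')\<in>UNIV. agree k a a' \<longrightarrow> agree k b b' \<longrightarrow> g (a', b') n = g (a, b) n"
      by blast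
  qed
  from k2_rep2[OF this] obtain p where p: "\<And>a b. app2 k2_app p a b = Some (g (a, b))"
    by blast
  have "g (k2_seq xs, x) n = k2_seq (xs @ [x]) n" for xs x n
    by (cases n; cases "prod_decode (n - 1)") (simp_all add: g_def k2_seq_def nth_append)
  then have "g (k2_seq xs, x) = k2_seq (xs @ [x])" for xs x
    by (simp add: fun_eq_iff)
  then show "\<exists>p. \<forall>xs x. app2 k2_app p (k2_seq xs) x = Some (k2_seq (xs @ [x]))"
    by (intro exI[of _ p]) (simp add: p)
qed

end

theory Submission
  imports Defs
begin

text \<open>
  Suppose \<open>S\<close> is continuous on \<open>V\<close>, and call a finite initial segment together with a finite set of
  forbidden positive values a condition. Every condition extends to one that no point of \<open>V\<close> meets.
  Take a new value \<open>m > 0\<close>. If no point of \<open>V\<close> that meets the condition omits \<open>m\<close>, forbid \<open>m\<close>.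
  Otherwise some such point omits \<open>m\<close>, so by continuity all points of \<open>V\<close> that agree with it on some
  initial segment omit \<open>m\<close>; prolong that initial segment by the value \<open>m\<close>. Iterating over a
  sequence of sets \<open>V\<^sub>i\<close> yields a point outside all of them.

  For the second part, a computation of \<open>S\<close> relative to \<open>F\<close> receives a finite list of answers. If
  \<open>F\<close> has countable image there are only countably many such lists, and for a fixed list the
  result depends continuously on the input.
\<close>

text \<open>The finite initial segment of a condition is kept as a total function \<open>x\<close>
  together with a length \<open>k\<close>; the values of \<open>x\<close> from \<open>k\<close> on
  do not constrain \<open>y\<close>.\<close>

definition meets :: "nat \<Rightarrow> baire \<Rightarrow> nat set \<Rightarrow> baire \<Rightarrow> bool" where
  "meets k x A y \<longleftrightarrow> agree k x y \<and> A \<inter> range y = {}"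

lemma ex_extension_avoiding:
  assumes cont: "continuous_on V missing_succ"
    and fin: "finite A" and zero: "0 \<notin> A" and x: "A \<inter> range x = {}"
  shows "\<exists>k' x' A'. k < k' \<and> agree k x x' \<and> A \<subseteq> A' \<and> finite A' \<and> 0 \<notin> A' \<and> A' \<inter> range x' = {} \<and>
    (\<forall>y\<in>V. \<not> meets k' x' A' y)"
proof -
  have "finite (insert 0 (A \<union> x ` {..<k}))"
    using fin by simp
  \<comment> \<open>\<open>m\<close> is positive, so that \<open>missing_succ\<close> detects
    whether it is omitted; it is neither forbidden nor among the first \<open>k\<close> values, so
    that it can still be taken or forbidden.\<close>
  then obtain m where m: "m \<notin> insert 0 (A \<union> x ` {..<k})"
    using ex_new_if_finite infinite_UNIV_nat by blast
  \<comment> \<open>Padding with 0, which is never forbidden, keeps \<open>range z\<close> disjoint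
    from \<open>insert m A\<close>.\<close>
  define z where "z i = (if i < k then x i else 0)" for i
  show ?thesis
  \<comment> \<open>Testing at length \<open>Suc k\<close> lets the segment grow even when
    \<open>m\<close> is merely forbidden.\<close>
  proof (cases "\<exists>y\<in>V. meets (Suc k) z (insert m A) y")
    case False
    have "insert m A \<inter> range z = {}"
      using m x zero by (auto simp: z_def)
    moreover have "agree k x z"
      by (simp add: agree_def z_def)
    ultimately show ?thesis
      using False fin zero m
      by (intro exI[of _ "Suc k"] exI[of _ z] exI[of _ "insert m A"]) auto
  next
    case True
    then obtain y where y: "y \<in> V" "agree (Suc k) z y" "insert m A \<inter> range y = {}"
      by (auto simp: meets_def)
    obtain n where n: "m = Suc n"
      using m by (cases m) auto
    obtain l where l: "\<And>w. w \<in> V \<Longrightarrow> agree l y w \<Longrightarrow> missing_succ w n = missing_succ y n"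
      using cont y(1) unfolding continuous_on_baire_iff by blast
    \<comment> \<open>The single coordinate \<open>n\<close> decides the matter:
      \<open>missing_succ w n\<close> is \<open>m\<close> if \<open>w\<close> omits
      \<open>m\<close>, and 0 otherwise.\<close>
    have omit: "m \<notin> range w" if "w \<in> V" "agree l y w" for w
    proof -
      have "missing_succ w n = Suc n"
        using l[OF that] y(3) n by (simp add: missing_succ_def)
      then show ?thesis
        using n by (simp add: missing_succ_def split: if_splits)
    qed
    \<comment> \<open>Position \<open>j\<close> lies past both segments: putting \<open>m\<close>
      there preserves agreement with \<open>x\<close> below \<open>k\<close> and with
      \<open>y\<close> below \<open>l\<close>, so a point of \<open>V\<close> meeting the new
      condition would both omit and take \<open>m\<close>.\<close>
    define j where "j = max k l"
    define x' where "x' = y(j := m)"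
    have "agree k x x'"
      unfolding agree_def
    proof (intro allI impI)
      fix i
      assume "i < k"
      then show "x i = x' i"
        using y(2)[unfolded agree_def, rule_format, of i] unfolding z_def x'_def j_def by auto
    qed
    moreover have "A \<inter> range x' = {}"
      using y(3) m by (auto simp: x'_def)
    moreover have "\<not> meets (Suc j) x' A w" if "w \<in> V" for w
    proof
      assume "meets (Suc j) x' A w"
      then have w: "agree (Suc j) x' w"
        by (simp add: meets_def)
      then have "w j = m"
        unfolding agree_def x'_def by (metis fun_upd_same lessI)
      moreover have "agree l y w"
        unfolding agree_def
      proof (intro allI impI)
        fix i
        assume "i < l"
        then have "i < j"
          by (simp add: j_def)
        then show "y i = w i"
          using w[unfolded agree_def, rule_format, of i] by (simp add: x'_def)
      qed
      ultimately show False
        using omit[OF that] by blast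
    qed
    ultimately show ?thesis
      using fin zero by (intro exI[of _ "Suc j"] exI[of _ x'] exI[of _ A]) (auto simp: j_def)
  qed
qed

lemma missing_succ_not_sigma_continuous:
  fixes V :: "nat \<Rightarrow> baire set"
  assumes cont: "\<And>i. continuous_on (V i) missing_succ"
  shows "(\<Union>i. V i) \<noteq> UNIV"
proof -
  define P where "P = (\<lambda>(k :: nat, x :: baire, A). finite A \<and> 0 \<notin> A \<and> A \<inter> range x = {})"
  define Q where "Q n = (\<lambda>(k, x, A) (k', x', A'). k < k' \<and> agree k x x' \<and> A \<subseteq> A' \<and>
    (\<forall>y\<in>V n. \<not> meets k' x' A' y))" for n
  have "\<exists>c. \<forall>n. P (c n) \<and> Q n (c n) (c (Suc n))"
  proof (rule dependent_nat_choice)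
    show "\<exists>c. P c"
      by (intro exI[of _ "(0, \<lambda>_. 0, {})"]) (simp add: P_def)
  next
    fix c n
    assume "P c"
    obtain k x A where kxA: "c = (k, x, A)"
      by (cases c)
    then obtain k' x' A' where "k < k'" "agree k x x'" "A \<subseteq> A'" "finite A'" "0 \<notin> A'"
      "A' \<inter> range x' = {}" "\<forall>y\<in>V n. \<not> meets k' x' A' y"
      using ex_extension_avoiding[OF cont[of n], of A x k] \<open>P c\<close> by (auto simp: P_def)
    then show "\<exists>c'. P c' \<and> Q n c c'"
      by (intro exI[of _ "(k', x', A')"]) (simp add: P_def Q_def kxA)
  qed
  then obtain c where c: "\<And>n. P (c n)" "\<And>n. Q n (c n) (c (Suc n))"
    by blast
  define k where "k n = fst (c n)" for n
  define x where "x n = fst (snd (c n))" for n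
  define A where "A n = snd (snd (c n))" for n
  have A: "A n \<inter> range (x n) = {}" for n
    using c(1)[of n] by (simp add: P_def A_def x_def split_beta)
  have step: "k n < k (Suc n)" "agree (k n) (x n) (x (Suc n))" "A n \<subseteq> A (Suc n)"
    "y \<in> V n \<Longrightarrow> \<not> meets (k (Suc n)) (x (Suc n)) (A (Suc n)) y" for n y
    using c(2)[of n] by (simp_all add: Q_def k_def x_def A_def split_beta)
  have k_mono: "k n \<le> k m" if "n \<le> m" for n m
    using lift_Suc_mono_le[of k, OF less_imp_le[OF step(1)] that] .
  have A_mono: "A n \<subseteq> A m" if "n \<le> m" for n m
    using lift_Suc_mono_le[of A, OF step(3) that] .
  have x_stable: "x m i = x n i" if "n \<le> m" "i < k n" for n m i
    using that
  proof (induction m rule: dec_induct)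
    case (step m)
    then have "i < k m"
      using k_mono[of n m] by simp
    then show ?case
      using \<open>agree (k m) (x m) (x (Suc m))\<close> step by (simp add: agree_def)
  qed simp
  have k_ge: "n \<le> k n" for n
    by (induction n) (use step(1) in \<open>auto intro: le_less_trans Suc_leI\<close>)
  \<comment> \<open>By \<open>k_ge\<close>, stage \<open>Suc i\<close> has already fixed the value
    at \<open>i\<close>.\<close>
  define a where "a i = x (Suc i) i" for i
  have a: "a i = x m i" if "i < m" for i m
    using x_stable[of "Suc i" m i] k_ge[of "Suc i"] that by (simp add: a_def)
  have "meets (k n) (x n) (A n) a" for n
    unfolding meets_def
  proof
    have "x n i = a i" if "i < k n" for i
      using x_stable[of n "max n (Suc i)" i] a[of i "max n (Suc i)"] that by simp
    then show "agree (k n) (x n) a"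
      by (simp add: agree_def)
    \<comment> \<open>At a late stage \<open>m\<close> the value \<open>a i\<close> belongs to
      \<open>x m\<close>, whose range avoids \<open>A m\<close> and hence the smaller set
      \<open>A n\<close>.\<close>
    have "a i \<notin> A n" for i
      using A[of "max n (Suc i)"] A_mono[of n "max n (Suc i)"] a[of i "max n (Suc i)"] by auto
    then show "A n \<inter> range a = {}"
      by blast
  qed
  then have "a \<notin> V n" for n
    using step(4) by blast
  then show ?thesis
    by blast
qed

lemma continuous_on_k2_app_Some:
  assumes "continuous_on X f" and "continuous_on X g"
    and app: "\<And>x. x \<in> X \<Longrightarrow> k2_app (f x) (g x) = Some (h x)"
  shows "continuous_on X h"
proof -
  have "continuous_on X (\<lambda>x. (f x, g x))"
    using assms(1,2) by (rule continuous_on_Pair)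
  then have "continuous_on X (\<lambda>x. the (k2_app (fst (f x, g x)) (snd (f x, g x))))"
    by (rule continuous_on_compose2[OF continuous_on_k2_app]) (auto simp: app)
  then show ?thesis
    by (rule continuous_on_eq) (simp add: app)
qed

lemma continuous_on_k2_app2_Some:
  assumes "continuous_on X f" and "continuous_on X g" and "continuous_on X h"
    and app: "\<And>x. x \<in> X \<Longrightarrow> app2 k2_app (f x) (g x) (h x) = Some (t x)"
  shows "continuous_on X t"
proof -
  have *: "k2_app (f x) (g x) = Some (the (k2_app (f x) (g x)))"
    "k2_app (the (k2_app (f x) (g x))) (h x) = Some (t x)" if "x \<in> X" for x
    using app[OF that] by (auto simp: app2_def Option.bind_eq_Some_conv)
  show ?thesis
    by (rule continuous_on_k2_app_Some[OF continuous_on_k2_app_Some[OF assms(1,2) *(1)] assms(3) *(2)])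
qed

text \<open>The coding is arbitrary, so continuity has to come from representability: the code
  arises from \<open>sq []\<close> by appending first \<open>x\<close> and then each entry of
  \<open>ys\<close>, and application is continuous where defined.\<close>

lemma continuous_on_sequence_code:
  assumes "pca_coding k2_app tt ff pair num sq"
  shows "continuous_on X (\<lambda>x. sq (x # ys))"
proof -
  interpret pca_coding k2_app tt ff pair num sq
    by (fact assms)
  obtain p where p: "\<And>xs x. app2 k2_app p (sq xs) x = Some (sq (xs @ [x]))"
    using ex_append by blast
  show ?thesis
  proof (induction ys rule: rev_induct)
    case Nil
    show ?case
      by (rule continuous_on_k2_app2_Some[OF continuous_on_const continuous_on_const continuous_on_id])
        (use p[of "[]"] in simp)
  next
    case (snoc y ys)
    show ?case
      by (rule continuous_on_k2_app2_Some[OF continuous_on_const snoc continuous_on_const])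
        (use p[of "_ # ys"] in simp)
  qed
qed

lemma oracle_representable_imp_sigma_continuous:
  fixes F g :: "baire \<Rightarrow> baire"
  assumes coding: "pca_coding k2_app tt ff pair num sq" and count: "countable (range F)"
    and repr: "representable (pca_coding.oracle_app k2_app tt ff pair sq (\<lambda>x. Some (F x)))
      (\<lambda>x. Some (g x))"
  shows "\<exists>V :: nat \<Rightarrow> baire set. (\<Union>i. V i) = UNIV \<and> (\<forall>i. continuous_on (V i) g)"
proof -
  interpret pca_coding k2_app tt ff pair num sq
    by (fact coding)
  obtain r where r: "\<And>x. oracle_run (\<lambda>x. Some (F x)) r x (g x)"
    using repr by (auto simp: representable_def oracle_app_eq_Some_iff)
  obtain q where q: "\<And>a b. k2_app q (pair a b) = Some b"
    using ex_snd by blast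
  \<comment> \<open>\<open>W ys\<close> records only the halting step on answers \<open>ys\<close>;
    the queries that led to them do not affect the result.\<close>
  define W where "W ys = {x. k2_app r (sq (x # ys)) = Some (pair tt (g x))}" for ys
  have cont: "continuous_on (W ys) g" for ys
  proof (rule continuous_on_k2_app_Some[OF continuous_on_const _ q])
    show "continuous_on (W ys) (\<lambda>x. pair tt (g x))"
      by (rule continuous_on_k2_app_Some[OF continuous_on_const continuous_on_sequence_code[OF coding]])
        (simp add: W_def)
  qed
  let ?L = "lists (range F)"
  have L: "countable ?L" "?L \<noteq> {}"
    using count by auto
  have "\<exists>ys\<in>?L. x \<in> W ys" for x
  proof -
    obtain es where "k2_app r (sq (x # map (the \<circ> (\<lambda>x. Some (F x))) es)) = Some (pair tt (g x))"
      using r[of x] unfolding oracle_run_def by blast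
    then have "x \<in> W (map F es)"
      by (simp add: W_def comp_def)
    then show ?thesis
      by (intro bexI[of _ "map F es"]) auto
  qed
  then have "(\<Union>ys\<in>?L. W ys) = UNIV"
    by blast
  moreover have "(\<Union>i. W (from_nat_into ?L i)) = \<Union> (W ` range (from_nat_into ?L))"
    by (simp only: image_image)
  ultimately have "(\<Union>i. W (from_nat_into ?L i)) = UNIV"
    by (simp only: range_from_nat_into[OF L(2,1)])
  then show ?thesis
    using cont by blast
qed

theorem theorem3p3:
  shows "(\<nexists>V :: nat \<Rightarrow> (nat \<Rightarrow> nat) set.
            (\<Union>i. V i) = UNIV \<and> (\<forall>i. continuous_on (V i) missing_succ)) \<and>
         (\<forall>tt ff pair num sq. pca_coding k2_app tt ff pair num sq \<longrightarrow>
            (\<forall>F :: (nat \<Rightarrow> nat) \<Rightarrow> (nat \<Rightarrow> nat). countable (range F) \<longrightarrow>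
               \<not> representable (pca_coding.oracle_app k2_app tt ff pair sq (\<lambda>x. Some (F x)))
                   (\<lambda>x. Some (missing_succ x))))"
proof (intro conjI allI impI notI)
  assume "\<exists>V :: nat \<Rightarrow> baire set. (\<Union>i. V i) = UNIV \<and> (\<forall>i. continuous_on (V i) missing_succ)"
  then show False
    using missing_succ_not_sigma_continuous by blast
next
  fix tt ff pair num sq and F :: "baire \<Rightarrow> baire"
  assume "pca_coding k2_app tt ff pair num sq" and "countable (range F)"
    and "representable (pca_coding.oracle_app k2_app tt ff pair sq (\<lambda>x. Some (F x)))
      (\<lambda>x. Some (missing_succ x))"
  from oracle_representable_imp_sigma_continuous[OF this] show False
    using missing_succ_not_sigma_continuous by blast
qed

end
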